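(* Let $X$ be a reflexive complex Banach space and let $T\in B(X)$ be Kreiss bounded. Then $\sigma_R(T)\subset \mathbb{D}$, where $\mathbb{D}=\{\lambda\in\mathbb{C}:|\lambda|<1\}$ is the open unit disc.
   Context: $B(X)$ denotes the space of all bounded linear operators on $X$. An operator $T\in B(X)$ is Kreiss bounded if there exists $C>0$ such that for every $\lambda\in\mathbb{C}$ with $|\lambda|>1$ the operator $\lambda I-T$ is invertible and $\|(\lambda I-T)^{-1}\|\le \frac{C}{|\lambda|-1}$. The residual spectrum $\sigma_R(T)$ is the set of all $\lambda\in\mathbb{C}$ such that $T-\lambda I$ is injective and $\overline{R(T-\lambda I)}\ne X$, where $R(\cdot)$ denotes the range. *)

theory Defs
  imports "HOL-Analysis.Analysis"
begin

text \<open>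
  Complex normed spaces are built on top of the real ones, so that norm, topology and
  completeness are those of the library; the real scalar multiplication is the restriction
  of the complex one.
\<close>

class scaleC =
  fixes scaleC :: "complex \<Rightarrow> 'a \<Rightarrow> 'a"  (infixr "*\<^sub>C" 75)

class complex_vector = scaleC + real_vector +
  assumes scaleC_add_right: "a *\<^sub>C (x + y) = a *\<^sub>C x + a *\<^sub>C y"
    and scaleC_add_left: "(a + b) *\<^sub>C x = a *\<^sub>C x + b *\<^sub>C x"
    and scaleC_scaleC: "a *\<^sub>C b *\<^sub>C x = (a * b) *\<^sub>C x"
    and scaleC_one: "1 *\<^sub>C x = x"
    and scaleR_scaleC: "r *\<^sub>R x = complex_of_real r *\<^sub>C x"

class complex_normed_vector = complex_vector + real_normed_vector +
  assumes norm_scaleC: "norm (a *\<^sub>C x) = cmod a * norm x"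

class complex_banach = complex_normed_vector + banach

instantiation complex :: complex_banach
begin

definition scaleC_complex :: "complex \<Rightarrow> complex \<Rightarrow> complex"
  where "scaleC_complex a x = a * x"

instance
  by standard (simp_all add: scaleC_complex_def algebra_simps norm_mult scaleR_conv_of_real)

end

definition bounded_clinear ::
    "('a::complex_normed_vector \<Rightarrow> 'b::complex_normed_vector) \<Rightarrow> bool"
  where "bounded_clinear f \<longleftrightarrow> bounded_linear f \<and> (\<forall>a x. f (a *\<^sub>C x) = a *\<^sub>C f x)"

definition dual_space :: "('a::complex_normed_vector \<Rightarrow> complex) set"
  where "dual_space = {f. bounded_clinear f}"

text \<open>
  Elements of the bidual are represented by functions on all of \<open>'a \<Rightarrow> complex\<close>, of which
  only the values on the dual space matter. The norm on the dual space is the operator norm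
  \<^const>\<open>onorm\<close>.
\<close>

definition bidual_space :: "(('a::complex_normed_vector \<Rightarrow> complex) \<Rightarrow> complex) set"
  where "bidual_space = {\<Phi>.
    (\<forall>f\<in>dual_space. \<forall>g\<in>dual_space. \<Phi> (\<lambda>x. f x + g x) = \<Phi> f + \<Phi> g) \<and>
    (\<forall>a. \<forall>f\<in>dual_space. \<Phi> (\<lambda>x. a * f x) = a * \<Phi> f) \<and>
    (\<exists>K. \<forall>f\<in>dual_space. cmod (\<Phi> f) \<le> K * onorm f)}"

text \<open>Reflexivity: the canonical embedding into the bidual is surjective.\<close>

definition reflexive_space :: "'a::complex_normed_vector itself \<Rightarrow> bool"
  where "reflexive_space (_ :: 'a itself) \<longleftrightarrow>
    (\<forall>\<Phi>\<in>bidual_space. \<exists>x::'a. \<forall>f\<in>dual_space. \<Phi> f = f x)"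

definition invertible_op :: "('a::complex_normed_vector \<Rightarrow> 'a) \<Rightarrow> bool"
  where "invertible_op A \<longleftrightarrow> (\<exists>S. bounded_clinear S \<and> S \<circ> A = id \<and> A \<circ> S = id)"

definition kreiss_bounded :: "('a::complex_normed_vector \<Rightarrow> 'a) \<Rightarrow> bool"
  where "kreiss_bounded T \<longleftrightarrow> (\<exists>C>0. \<forall>\<mu>. cmod \<mu> > 1 \<longrightarrow>
    invertible_op (\<lambda>x. \<mu> *\<^sub>C x - T x) \<and>
    onorm (inv (\<lambda>x. \<mu> *\<^sub>C x - T x)) \<le> C / (cmod \<mu> - 1))"

definition residual_spectrum :: "('a::complex_normed_vector \<Rightarrow> 'a) \<Rightarrow> complex set"
  where "residual_spectrum T = {\<mu>.
    inj (\<lambda>x. T x - \<mu> *\<^sub>C x) \<and> closure (range (\<lambda>x. T x - \<mu> *\<^sub>C x)) \<noteq> UNIV}"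

end

theory Submission
  imports Defs
begin

text \<open>
  Suppose \<open>|\<mu>| = 1\<close>, \<open>T - \<mu>\<close> is injective and its range is not dense, and let \<open>u \<noteq> 0\<close> be a real
  functional vanishing on that range. For \<open>r > 1\<close> put \<open>A\<^sub>r = (r - 1) \<mu> (r \<mu> - T)\<^sup>-\<^sup>1\<close>. The Kreiss
  condition says \<open>\<parallel>A\<^sub>r\<parallel> \<le> C\<close>, and moreover \<open>u \<circ> A\<^sub>r = u\<close>, while \<open>(T - \<mu>) A\<^sub>r \<rightarrow> 0\<close> in norm as
  \<open>r \<rightarrow> 1\<close>. Hence \<open>u\<close> has positive distance from the functionals \<open>g \<circ> (T - \<mu>)\<close>, so some element
  of the bidual annihilates all of these but not \<open>u\<close>. By reflexivity it is the evaluation at a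
  vector \<open>y\<close>; then \<open>(T - \<mu>) y = 0\<close> and \<open>u y \<noteq> 0\<close>, contradicting injectivity.
\<close>

section \<open>Sublinear functionals and dominated linear functionals\<close>

text \<open>Positive homogeneity follows from the inequality below by applying it to \<open>t\<close> and \<open>1 / t\<close>.\<close>

definition sublinear :: "('a::real_vector \<Rightarrow> real) \<Rightarrow> bool"
  where "sublinear p \<longleftrightarrow>
    (\<forall>x y. p (x + y) \<le> p x + p y) \<and> (\<forall>t>0. \<forall>x. p (t *\<^sub>R x) \<le> t * p x)"

lemma sublinearI:
  assumes "\<And>x y. p (x + y) \<le> p x + p y" and "\<And>t x. t > 0 \<Longrightarrow> p (t *\<^sub>R x) \<le> t * p x"
  shows "sublinear p"
  using assms by (simp add: sublinear_def)

lemma sublinear_add: "sublinear p \<Longrightarrow> p (x + y) \<le> p x + p y"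
  by (simp add: sublinear_def)

lemma sublinear_scaleR_le: "sublinear p \<Longrightarrow> t > 0 \<Longrightarrow> p (t *\<^sub>R x) \<le> t * p x"
  by (simp add: sublinear_def)

lemma sublinear_zero:
  assumes "sublinear p"
  shows "p 0 = 0"
  using sublinear_scaleR_le[OF assms, of 2 0] sublinear_scaleR_le[OF assms, of "1/2" 0] by simp

lemma sublinear_scaleR:
  assumes "sublinear p" and "t \<ge> 0"
  shows "p (t *\<^sub>R x) = t * p x"
proof (cases "t = 0")
  case True
  then show ?thesis using sublinear_zero[OF assms(1)] by simp
next
  case False
  then have t: "t > 0" using assms(2) by simp
  have "p x \<le> inverse t * p (t *\<^sub>R x)"
    using sublinear_scaleR_le[OF assms(1), of "inverse t" "t *\<^sub>R x"] t by simp
  then have "t * p x \<le> p (t *\<^sub>R x)"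
    using t by (simp add: field_simps)
  then show ?thesis
    using sublinear_scaleR_le[OF assms(1) t, of x] by simp
qed

lemma sublinear_minus: "sublinear p \<Longrightarrow> - p (- x) \<le> p x"
  using sublinear_add[of p x "- x"] sublinear_zero[of p] by simp

text \<open>For sublinear \<open>p\<close> this is the largest sublinear functional below
  \<open>p\<close> whose value at \<open>- a\<close> is at most \<open>- p a\<close>. It serves both
  to show that minimal functionals are linear and to prescribe a value at \<open>a\<close>.\<close>

definition sublinear_shift :: "('a::real_vector \<Rightarrow> real) \<Rightarrow> 'a \<Rightarrow> 'a \<Rightarrow> real"
  where "sublinear_shift p a x = (INF t\<in>{0..}. p (x + t *\<^sub>R a) - t * p a)"

context
  fixes p :: "'a::real_vector \<Rightarrow> real" and a :: 'a
  assumes p: "sublinear p"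
begin

lemma sublinear_shift_le:
  assumes "t \<ge> 0"
  shows "sublinear_shift p a x \<le> p (x + t *\<^sub>R a) - t * p a"
proof -
  \<comment> \<open>A lower bound independent of \<open>s\<close>: without it the real infimum would
    have no useful value.\<close>
  have "- p (- x) \<le> p (x + s *\<^sub>R a) - s * p a" if "s \<ge> 0" for s
    using sublinear_add[OF p, of "x + s *\<^sub>R a" "- x"] sublinear_scaleR[OF p that, of a] by simp
  then have "bdd_below ((\<lambda>t. p (x + t *\<^sub>R a) - t * p a) ` {0..})"
    by (intro bdd_belowI2) auto
  then show ?thesis
    unfolding sublinear_shift_def using assms by (intro cINF_lower) auto
qed

lemma sublinear_shift_greatest:
  assumes "\<And>t. t \<ge> 0 \<Longrightarrow> c \<le> p (x + t *\<^sub>R a) - t * p a"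
  shows "c \<le> sublinear_shift p a x"
  unfolding sublinear_shift_def using assms by (intro cINF_greatest) auto

lemma sublinear_shift_le_self: "sublinear_shift p a x \<le> p x"
  using sublinear_shift_le[of 0 x] by simp

lemma sublinear_shift_minus: "sublinear_shift p a (- a) \<le> - p a"
  using sublinear_shift_le[of 1 "- a"] sublinear_zero[OF p] by simp

lemma sublinear_sublinear_shift: "sublinear (sublinear_shift p a)"
proof (rule sublinearI)
  fix x y
  \<comment> \<open>The parameters \<open>s\<close> for \<open>x\<close> and \<open>t\<close> for
    \<open>y\<close> combine to the admissible parameter \<open>s + t\<close> for
    \<open>x + y\<close>; the two infima are then taken one after the other.\<close>
  have "sublinear_shift p a (x + y) - (p (y + t *\<^sub>R a) - t * p a) \<le> sublinear_shift p a x"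
    if "t \<ge> 0" for t
  proof (rule sublinear_shift_greatest)
    fix s :: real assume "s \<ge> 0"
    then show "sublinear_shift p a (x + y) - (p (y + t *\<^sub>R a) - t * p a)
        \<le> p (x + s *\<^sub>R a) - s * p a"
      using sublinear_shift_le[of "s + t" "x + y"] that
        sublinear_add[OF p, of "x + s *\<^sub>R a" "y + t *\<^sub>R a"]
      by (simp add: algebra_simps)
  qed
  then have "sublinear_shift p a (x + y) - sublinear_shift p a x \<le> sublinear_shift p a y"
    by (intro sublinear_shift_greatest) (simp add: algebra_simps)
  then show "sublinear_shift p a (x + y) \<le> sublinear_shift p a x + sublinear_shift p a y"
    by simp
next
  fix t :: real and x assume t: "t > 0"
  have "sublinear_shift p a (t *\<^sub>R x) / t \<le> sublinear_shift p a x"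
  proof (rule sublinear_shift_greatest)
    fix s :: real assume s: "s \<ge> 0"
    have "sublinear_shift p a (t *\<^sub>R x) \<le> t * (p (x + s *\<^sub>R a) - s * p a)"
      using sublinear_shift_le[of "t * s" "t *\<^sub>R x"] s t sublinear_scaleR[OF p, of t "x + s *\<^sub>R a"]
      by (simp add: algebra_simps)
    then show "sublinear_shift p a (t *\<^sub>R x) / t \<le> p (x + s *\<^sub>R a) - s * p a"
      using t by (simp add: field_simps)
  qed
  then show "sublinear_shift p a (t *\<^sub>R x) \<le> t * sublinear_shift p a x"
    using t by (simp add: field_simps)
qed

end

text \<open>The bound is the pointwise infimum, finite because every member satisfies
  \<open>- p (- x) \<le> - q (- x) \<le> q x\<close>. Subadditivity needs the chain condition: of
  two members, the smaller one can be used at both \<open>x\<close> and \<open>y\<close>.\<close>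

lemma sublinear_chain_lower_bound:
  assumes "C \<noteq> {}" and sub: "\<And>q. q \<in> C \<Longrightarrow> sublinear q" and le: "\<And>q. q \<in> C \<Longrightarrow> q \<le> p"
    and chain: "\<And>q r. q \<in> C \<Longrightarrow> r \<in> C \<Longrightarrow> q \<le> r \<or> r \<le> q"
  shows "\<exists>m. sublinear m \<and> m \<le> p \<and> (\<forall>q\<in>C. m \<le> q)"
proof -
  define m where "m x = (INF q\<in>C. q x)" for x
  have m_le: "m x \<le> q x" if "q \<in> C" for q x
  proof -
    have "bdd_below ((\<lambda>q. q x) ` C)"
    proof (intro bdd_belowI2)
      fix q assume "q \<in> C"
      then show "- p (- x) \<le> q x"
        using sublinear_minus[OF sub, of q x] le[of q] by (auto dest!: le_funD[where x = "- x"])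
    qed
    then show ?thesis
      unfolding m_def using that by (rule cINF_lower)
  qed
  have m_ge: "c \<le> m x" if "\<And>q. q \<in> C \<Longrightarrow> c \<le> q x" for c x
    unfolding m_def using that assms(1) by (intro cINF_greatest)
  have "sublinear m"
  proof (rule sublinearI)
    fix x y
    have *: "m (x + y) \<le> q x + r y" if qr: "q \<in> C" "r \<in> C" for q r
    proof -
      obtain h where h: "h \<in> C" "h \<le> q" "h \<le> r"
        using chain[OF qr] qr by blast
      have "m (x + y) \<le> h x + h y"
        using m_le[OF h(1), of "x + y"] sublinear_add[OF sub[OF h(1)], of x y] by simp
      then show ?thesis
        using le_funD[OF h(2), of x] le_funD[OF h(3), of y] by simp
    qed
    have "m (x + y) - r y \<le> m x" if "r \<in> C" for r
      using *[OF _ that] by (intro m_ge) (simp add: algebra_simps)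
    then have "m (x + y) - m x \<le> m y"
      by (intro m_ge) (simp add: algebra_simps)
    then show "m (x + y) \<le> m x + m y" by simp
  next
    fix t :: real and x assume t: "t > 0"
    have "m (t *\<^sub>R x) / t \<le> m x"
    proof (rule m_ge)
      fix q assume "q \<in> C"
      then show "m (t *\<^sub>R x) / t \<le> q x"
        using m_le[of q "t *\<^sub>R x"] sublinear_scaleR_le[OF sub t, of q x] t
        by (simp add: field_simps)
    qed
    then show "m (t *\<^sub>R x) \<le> t * m x"
      using t by (simp add: field_simps)
  qed
  moreover have "m \<le> p"
    using assms(1) m_le le by (meson all_not_in_conv le_funI order_trans)
  ultimately show ?thesis
    using m_le by (auto simp: le_fun_def)
qed

lemma exists_minimal_sublinear:
  assumes "sublinear p"
  shows "\<exists>m. sublinear m \<and> m \<le> p \<and> (\<forall>q. sublinear q \<longrightarrow> q \<le> m \<longrightarrow> q = m)"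
proof -
  define A where "A = {q. sublinear q \<and> q \<le> p}"
  have "\<exists>m\<in>A. \<forall>q\<in>A. q \<le> m \<longrightarrow> q = m"
  proof (rule predicate_Zorn)
    \<comment> \<open>The order is reversed, so the maximal element supplied by Zorn's lemma is a
      minimal functional.\<close>
    show "partial_order_on A (relation_of (\<lambda>q r :: 'a \<Rightarrow> real. r \<le> q) A)"
      by (rule partial_order_on_relation_ofI) auto
  next
    fix C assume C: "C \<in> Chains (relation_of (\<lambda>q r :: 'a \<Rightarrow> real. r \<le> q) A)"
    then have CA: "C \<subseteq> A" and ch: "\<And>q r. q \<in> C \<Longrightarrow> r \<in> C \<Longrightarrow> q \<le> r \<or> r \<le> q"
      by (auto simp: Chains_def relation_of_def)
    show "\<exists>m\<in>A. \<forall>q\<in>C. m \<le> q"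
    proof (cases "C = {}")
      case True
      then show ?thesis using assms by (auto simp: A_def)
    next
      case False
      then show ?thesis
        using sublinear_chain_lower_bound[of C p] CA ch by (auto simp: A_def)
    qed
  qed
  then show ?thesis
    unfolding A_def by (auto intro: order_trans)
qed

text \<open>The shift of \<open>m\<close> along any \<open>a\<close> lies below \<open>m\<close>, so
  minimality makes them equal and \<open>m (- a) \<le> - m a\<close>. Thus \<open>m\<close> is odd,
  and oddness turns the sublinear inequalities into equalities.\<close>

lemma minimal_sublinear_linear:
  assumes m: "sublinear m" and min: "\<And>q. sublinear q \<Longrightarrow> q \<le> m \<Longrightarrow> q = m"
  shows "linear m"
proof -
  have "sublinear_shift m a = m" for a
    using sublinear_sublinear_shift[OF m] sublinear_shift_le_self[OF m]
    by (intro min) (auto simp: le_fun_def)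
  then have odd: "m (- a) = - m a" for a
    using sublinear_shift_minus[OF m, of a] sublinear_minus[OF m, of a] by simp
  show ?thesis
  proof (rule linearI)
    show "m (x + y) = m x + m y" for x y
      using sublinear_add[OF m, of x y] sublinear_add[OF m, of "x + y" "- y"] odd[of y] by simp
    show "m (t *\<^sub>R x) = t *\<^sub>R m x" for t x
    proof (cases "t \<ge> 0")
      case True
      then show ?thesis using sublinear_scaleR[OF m, of t x] by simp
    next
      case False
      then show ?thesis using sublinear_scaleR[OF m, of "- t" x] odd[of "t *\<^sub>R x"] by simp
    qed
  qed
qed

text \<open>Minimizing below the shift of \<open>p\<close> along \<open>a\<close>, rather than below
  \<open>p\<close>, forces \<open>L (- a) \<le> - p a\<close>, that is
  \<open>L a \<ge> p a\<close>.\<close>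

theorem hahn_banach_sublinear:
  assumes "sublinear p"
  shows "\<exists>L. linear L \<and> L \<le> p \<and> L a = p a"
proof -
  obtain L where L: "sublinear L" "L \<le> sublinear_shift p a"
    and min: "\<forall>q. sublinear q \<longrightarrow> q \<le> L \<longrightarrow> q = L"
    using exists_minimal_sublinear[OF sublinear_sublinear_shift[OF assms]] by blast
  have lin: "linear L"
    using minimal_sublinear_linear[OF L(1)] min by blast
  have le: "L x \<le> p x" for x
    using le_funD[OF L(2), of x] sublinear_shift_le_self[OF assms, of a x] by simp
  have "- L a \<le> - p a"
    using le_funD[OF L(2), of "- a"] sublinear_shift_minus[OF assms, of a] linear_neg[OF lin, of a]
    by simp
  then show ?thesis
    using lin le le[of a] by (intro exI[of _ L]) (auto simp: le_fun_def)
qed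

section \<open>Separation of a point from a subspace\<close>

lemma sublinear_infdist:
  fixes S :: "'a::real_normed_vector set"
  assumes S: "subspace S"
  shows "sublinear (\<lambda>x. infdist x S)"
proof -
  have ne: "S \<noteq> {}" using subspace_0[OF S] by auto
  have ge: "c \<le> infdist x S" if "\<And>s. s \<in> S \<Longrightarrow> c \<le> dist x s" for c x
    unfolding infdist_def using ne that by (auto intro: cINF_greatest)
  show ?thesis
  proof (rule sublinearI)
    fix x y
    have *: "infdist (x + y) S \<le> dist x s + dist y t" if "s \<in> S" "t \<in> S" for s t
      using infdist_le[OF subspace_add[OF S that], of "x + y"] dist_triangle_add[of x y s t] by simp
    have "infdist (x + y) S - dist y t \<le> infdist x S" if "t \<in> S" for t
      using *[OF _ that] by (intro ge) (simp add: algebra_simps)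
    then have "infdist (x + y) S - infdist x S \<le> infdist y S"
      by (intro ge) (simp add: algebra_simps)
    then show "infdist (x + y) S \<le> infdist x S + infdist y S" by simp
  next
    fix t :: real and x :: 'a assume t: "t > 0"
    have "infdist (t *\<^sub>R x) S / t \<le> infdist x S"
    proof (rule ge)
      fix s assume "s \<in> S"
      then have "infdist (t *\<^sub>R x) S \<le> t * dist x s"
        using infdist_le[OF subspace_scale[OF S, of s t], of "t *\<^sub>R x"] t
        by (simp add: dist_norm flip: scaleR_diff_right)
      then show "infdist (t *\<^sub>R x) S / t \<le> dist x s"
        using t by (simp add: field_simps)
    qed
    then show "infdist (t *\<^sub>R x) S \<le> t * infdist x S"
      using t by (simp add: field_simps)
  qed
qed

text \<open>The distance to \<open>S\<close> is at most the norm, zero on \<open>S\<close> and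
  positive off its closure. A linear functional dominated by it and equal to it at \<open>a\<close>
  is therefore continuous, vanishes on \<open>S\<close> and is nonzero at \<open>a\<close>.\<close>

theorem hahn_banach_separation:
  fixes S :: "'a::real_normed_vector set"
  assumes S: "subspace S" and a: "a \<notin> closure S"
  shows "\<exists>L :: 'a \<Rightarrow>\<^sub>L real. L a \<noteq> 0 \<and> (\<forall>s\<in>S. L s = 0)"
proof -
  have ne: "S \<noteq> {}" using subspace_0[OF S] by auto
  obtain L where lin: "linear L" and le: "\<And>x. L x \<le> infdist x S" and eq: "L a = infdist a S"
    using hahn_banach_sublinear[OF sublinear_infdist[OF S], of a] by (auto simp: le_fun_def)
  have abs_le: "\<bar>L x\<bar> \<le> infdist x S \<or> \<bar>L x\<bar> \<le> infdist (- x) S" for x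
    using le[of x] le[of "- x"] linear_neg[OF lin, of x] by linarith
  have bl: "bounded_linear L"
  proof (rule bounded_linear_intro[where K = 1])
    show "norm (L x) \<le> norm x * 1" for x
      using abs_le[of x] infdist_le[OF subspace_0[OF S], of x]
        infdist_le[OF subspace_0[OF S], of "- x"] by auto
  qed (use linear_add[OF lin] linear_scale[OF lin] in auto)
  have "L s = 0" if "s \<in> S" for s
    using abs_le[of s] that subspace_neg[OF S that] by auto
  moreover have "L a \<noteq> 0"
    using in_closure_iff_infdist_zero[OF ne, of a] a eq by simp
  ultimately show ?thesis
    using bl by (intro exI[of _ "Blinfun L"]) (simp add: bounded_linear_Blinfun_apply)
qed

section \<open>Complex scalars, real functionals and reflexivity\<close>

lemma bounded_linear_scaleC: "bounded_linear (\<lambda>x::'a::complex_normed_vector. a *\<^sub>C x)"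
proof (rule bounded_linear_intro[where K = "cmod a"])
  fix r and x :: 'a
  show "a *\<^sub>C r *\<^sub>R x = r *\<^sub>R (a *\<^sub>C x)"
    by (simp add: scaleR_scaleC scaleC_scaleC mult.commute)
qed (simp_all add: scaleC_add_right norm_scaleC)

lemma scaleC_diff_right: "a *\<^sub>C (x - y) = a *\<^sub>C x - a *\<^sub>C (y::'a::complex_normed_vector)"
  by (rule linear_diff[OF bounded_linear.linear[OF bounded_linear_scaleC]])

lemma scaleC_eq: "a *\<^sub>C x = Re a *\<^sub>R x + Im a *\<^sub>R (\<i> *\<^sub>C (x::'a::complex_vector))"
proof -
  have "a *\<^sub>C x = (complex_of_real (Re a) + complex_of_real (Im a) * \<i>) *\<^sub>C x"
    by (metis complex_eq mult.commute)
  then show ?thesis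
    by (simp only: scaleC_add_left scaleR_scaleC scaleC_scaleC)
qed

text \<open>The classical formula \<open>g x - \<i> * g (\<i> *\<^sub>C x)\<close> for the complex
  functional with real part \<open>g\<close>. Homogeneity comes from splitting the scalar into real
  and imaginary parts and using that applying \<open>\<i>\<close> twice gives
  \<open>- x\<close>.\<close>

lemma dual_space_complexification:
  fixes g :: "'a::complex_normed_vector \<Rightarrow>\<^sub>L real"
  shows "(\<lambda>x. Complex (g x) (- g (\<i> *\<^sub>C x))) \<in> dual_space"
proof -
  have "bounded_linear (\<lambda>x. complex_of_real (g x) - \<i> * complex_of_real (g (\<i> *\<^sub>C x)))"
    by (intro bounded_linear_sub bounded_linear_compose[OF bounded_linear_mult_right]
        bounded_linear_compose[OF bounded_linear_of_real]
        bounded_linear_compose[OF blinfun.bounded_linear_right] blinfun.bounded_linear_right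
        bounded_linear_scaleC)
  also have "(\<lambda>x. complex_of_real (g x) - \<i> * complex_of_real (g (\<i> *\<^sub>C x)))
      = (\<lambda>x. Complex (g x) (- g (\<i> *\<^sub>C x)))"
    by (auto simp: complex_eq_iff)
  finally have "bounded_linear (\<lambda>x. Complex (g x) (- g (\<i> *\<^sub>C x)))" .
  moreover have "Complex (g (a *\<^sub>C x)) (- g (\<i> *\<^sub>C a *\<^sub>C x)) = a *\<^sub>C Complex (g x) (- g (\<i> *\<^sub>C x))"
    for a x
  proof -
    have "\<i> *\<^sub>C a *\<^sub>C x = a *\<^sub>C \<i> *\<^sub>C x"
      by (simp add: scaleC_scaleC mult.commute)
    moreover have "\<i> *\<^sub>C \<i> *\<^sub>C x = - x"
      using scaleR_scaleC[of "- 1" x] by (simp add: scaleC_scaleC)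
    ultimately show ?thesis
      by (simp add: scaleC_eq[of a x] scaleC_eq[of a "\<i> *\<^sub>C x"] blinfun.bilinear_simps
          scaleC_complex_def complex_eq_iff)
  qed
  ultimately show ?thesis
    by (simp add: dual_space_def bounded_clinear_def)
qed

text \<open>
  The complex bidual element is obtained from the real functional \<open>L\<close> by applying it separately
  to the real and imaginary parts.
\<close>

lemma reflexive_space_real:
  fixes L :: "('a::complex_normed_vector \<Rightarrow>\<^sub>L real) \<Rightarrow>\<^sub>L real"
  assumes "reflexive_space TYPE('a)"
  shows "\<exists>y. \<forall>g. L g = g y"
proof -
  define re where "re f = Blinfun (\<lambda>x. Re (f x))" for f :: "'a \<Rightarrow> complex"
  define im where "im f = Blinfun (\<lambda>x. Im (f x))" for f :: "'a \<Rightarrow> complex"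
  define \<Phi> where "\<Phi> f = Complex (L (re f)) (L (im f))" for f
  have bl: "bounded_linear f" if "f \<in> dual_space" for f :: "'a \<Rightarrow> complex"
    using that by (simp add: dual_space_def bounded_clinear_def)
  \<comment> \<open>\<open>Blinfun\<close> is specified only on bounded linear maps, so these
    equations carry that hypothesis.\<close>
  have re: "re f x = Re (f x)" and im: "im f x = Im (f x)" if "bounded_linear f" for f x
    unfolding re_def im_def
    by (simp_all add: bounded_linear_Blinfun_apply bounded_linear_compose[OF bounded_linear_Re that]
        bounded_linear_compose[OF bounded_linear_Im that])
  have "\<Phi> \<in> bidual_space"
    unfolding bidual_space_def
  proof (intro CollectI conjI ballI allI)
    fix f g :: "'a \<Rightarrow> complex" assume "f \<in> dual_space" "g \<in> dual_space"
    then have f: "bounded_linear f" and g: "bounded_linear g" by (simp_all add: bl)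
    have "re (\<lambda>x. f x + g x) = re f + re g" "im (\<lambda>x. f x + g x) = im f + im g"
      by (auto intro!: blinfun_eqI simp: re im f g bounded_linear_add blinfun.bilinear_simps)
    then show "\<Phi> (\<lambda>x. f x + g x) = \<Phi> f + \<Phi> g"
      by (simp add: \<Phi>_def blinfun.bilinear_simps complex_eq_iff)
  next
    fix a and f :: "'a \<Rightarrow> complex" assume "f \<in> dual_space"
    then have f: "bounded_linear f" by (rule bl)
    have af: "bounded_linear (\<lambda>x. a * f x)"
      by (rule bounded_linear_compose[OF bounded_linear_mult_right f])
    \<comment> \<open>With these product rules, real linearity of \<open>L\<close> already yields
      complex homogeneity of \<open>\<Phi>\<close>.\<close>
    have "re (\<lambda>x. a * f x) = Re a *\<^sub>R re f - Im a *\<^sub>R im f"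
      "im (\<lambda>x. a * f x) = Re a *\<^sub>R im f + Im a *\<^sub>R re f"
      by (auto intro!: blinfun_eqI simp: re im f af blinfun.bilinear_simps)
    then show "\<Phi> (\<lambda>x. a * f x) = a * \<Phi> f"
      by (simp add: \<Phi>_def blinfun.bilinear_simps complex_eq_iff)
  next
    show "\<exists>K. \<forall>f\<in>dual_space. cmod (\<Phi> f) \<le> K * onorm f"
    proof (intro exI ballI)
      fix f :: "'a \<Rightarrow> complex" assume "f \<in> dual_space"
      then have f: "bounded_linear f" by (rule bl)
      have nonneg: "0 \<le> onorm f" by (rule onorm_pos_le[OF f])
      have "norm (re f) \<le> onorm f"
      proof (rule norm_blinfun_bound[OF nonneg])
        show "norm (re f x) \<le> onorm f * norm x" for x
          using onorm[OF f, of x] abs_Re_le_cmod[of "f x"] by (simp add: re f)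
      qed
      moreover have "norm (im f) \<le> onorm f"
      proof (rule norm_blinfun_bound[OF nonneg])
        show "norm (im f x) \<le> onorm f * norm x" for x
          using onorm[OF f, of x] abs_Im_le_cmod[of "f x"] by (simp add: im f)
      qed
      ultimately have "\<bar>L (re f)\<bar> \<le> norm L * onorm f" "\<bar>L (im f)\<bar> \<le> norm L * onorm f"
        using norm_blinfun[of L "re f"] norm_blinfun[of L "im f"]
          mult_left_mono[of "norm (re f)" "onorm f" "norm L"]
          mult_left_mono[of "norm (im f)" "onorm f" "norm L"] by auto
      \<comment> \<open>The factor 2 comes from bounding the modulus by the sum of the absolute
        values of the real and imaginary parts.\<close>
      then show "cmod (\<Phi> f) \<le> (2 * norm L) * onorm f"
        using cmod_le[of "\<Phi> f"] by (simp add: \<Phi>_def)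
    qed
  qed
  then obtain y where y: "\<And>f. f \<in> dual_space \<Longrightarrow> \<Phi> f = f y"
    using assms unfolding reflexive_space_def by blast
  have "L g = g y" for g
  proof -
    let ?f = "\<lambda>x. Complex (g x) (- g (\<i> *\<^sub>C x))"
    have f: "?f \<in> dual_space" by (rule dual_space_complexification)
    have "re ?f = g"
      by (rule blinfun_eqI) (simp add: re bl[OF f])
    then show ?thesis
      using arg_cong[OF y[OF f], of Re] by (simp add: \<Phi>_def)
  qed
  then show ?thesis by blast
qed

section \<open>Resolvent estimates from the Kreiss condition\<close>

text \<open>Trades \<open>inv\<close> and \<open>onorm\<close> for a solution \<open>z\<close> with
  a norm estimate, the form used below. The two-sided inverse \<open>S\<close> from invertibility is
  the function \<open>inv\<close> of the Kreiss condition.\<close>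

lemma kreiss_bounded_resolvent:
  fixes T :: "'a::complex_normed_vector \<Rightarrow> 'a"
  assumes "kreiss_bounded T"
  obtains C where "C > 0"
    and "\<And>\<mu> x. cmod \<mu> > 1 \<Longrightarrow> \<exists>z. \<mu> *\<^sub>C z - T z = x \<and> (cmod \<mu> - 1) * norm z \<le> C * norm x"
proof -
  obtain C where C: "C > 0" and inv: "\<And>\<mu>. cmod \<mu> > 1 \<Longrightarrow> invertible_op (\<lambda>x. \<mu> *\<^sub>C x - T x)"
    and bound: "\<And>\<mu>. cmod \<mu> > 1 \<Longrightarrow> onorm (inv (\<lambda>x. \<mu> *\<^sub>C x - T x)) \<le> C / (cmod \<mu> - 1)"
    using assms unfolding kreiss_bounded_def by blast
  have "\<exists>z. \<mu> *\<^sub>C z - T z = x \<and> (cmod \<mu> - 1) * norm z \<le> C * norm x" if \<mu>: "cmod \<mu> > 1" for \<mu> x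
  proof -
    obtain S where S: "bounded_clinear S" "S \<circ> (\<lambda>x. \<mu> *\<^sub>C x - T x) = id"
      "(\<lambda>x. \<mu> *\<^sub>C x - T x) \<circ> S = id"
      using inv[OF \<mu>] unfolding invertible_op_def by blast
    have "inv (\<lambda>x. \<mu> *\<^sub>C x - T x) = S"
      by (rule inv_unique_comp[OF S(3,2)])
    then have "onorm S \<le> C / (cmod \<mu> - 1)"
      using bound[OF \<mu>] by simp
    then have "norm (S x) \<le> C / (cmod \<mu> - 1) * norm x"
      using onorm[of S x] S(1) by (meson bounded_clinear_def mult_right_mono norm_ge_zero order_trans)
    then have "(cmod \<mu> - 1) * norm (S x) \<le> C * norm x"
      using \<mu> by (simp add: field_simps)
    then show ?thesis
      using fun_cong[OF S(3), of x] by auto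
  qed
  with C that show thesis by blast
qed

text \<open>This set is the range of the adjoint of \<open>B\<close> on real functionals, from which
  \<open>u\<close> is to be separated.\<close>

lemma subspace_range_compose:
  fixes B :: "'a::real_normed_vector \<Rightarrow>\<^sub>L 'b::real_normed_vector"
  shows "subspace (range (\<lambda>g :: 'b \<Rightarrow>\<^sub>L real. g o\<^sub>L B))"
proof -
  have "linear (\<lambda>g :: 'b \<Rightarrow>\<^sub>L real. g o\<^sub>L B)"
    by (rule linearI) (auto intro!: blinfun_eqI simp: blinfun.bilinear_simps)
  then show ?thesis
    using linear_subspace_image subspace_UNIV by blast
qed

text \<open>Evaluate \<open>u + g \<circ> B\<close> at \<open>w = A\<^sub>r x\<close> with \<open>r = 1 + e\<close>.\<close>

lemma kreiss_bounded_functional_bound: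
  fixes T :: "'a::complex_normed_vector \<Rightarrow> 'a" and u g B
  assumes T: "bounded_clinear T" and \<mu>: "cmod \<mu> = 1" and C: "C > 0"
    and res: "\<And>\<nu> x. cmod \<nu> > 1 \<Longrightarrow> \<exists>z. \<nu> *\<^sub>C z - T z = x \<and> (cmod \<nu> - 1) * norm z \<le> C * norm x"
    and B: "\<And>x. blinfun_apply B x = T x - \<mu> *\<^sub>C x"
    and u: "\<And>x. blinfun_apply u (T x - \<mu> *\<^sub>C x) = (0::real)"
  shows "\<bar>u x\<bar> \<le> norm (u + (g o\<^sub>L B)) * (C * norm x)"
proof -
  \<comment> \<open>\<open>e * D\<close> will bound \<open>\<bar>g (B w)\<bar>\<close>. Since
    \<open>D\<close> does not depend on \<open>e\<close>, this error disappears as \<open>e\<close>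
    tends to 0.\<close>
  define D where "D = norm g * ((C + 1) * norm x)"
  have *: "\<bar>u x\<bar> \<le> norm (u + (g o\<^sub>L B)) * (C * norm x) + e * D" if e: "e > 0" for e
  proof -
    define \<nu> where "\<nu> = complex_of_real (1 + e) * \<mu>"
    have cm: "cmod \<nu> = 1 + e"
      using e \<mu> unfolding \<nu>_def by (simp add: norm_mult del: of_real_add)
    obtain z where z: "\<nu> *\<^sub>C z - T z = x" "e * norm z \<le> C * norm x"
      using res[of \<nu> x] cm e by auto
    define w where "w = e *\<^sub>R (\<mu> *\<^sub>C z)"
    have nw: "norm w \<le> C * norm x"
      using z(2) e by (simp add: w_def norm_scaleC \<mu>)
    have \<nu>z: "\<nu> *\<^sub>C z = \<mu> *\<^sub>C z + w"
      by (simp add: w_def \<nu>_def scaleR_scaleC scaleC_scaleC scaleC_add_left algebra_simps)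
    \<comment> \<open>The resolvent equation writes \<open>x\<close> as \<open>w\<close> minus a
      vector of the range of \<open>B\<close>, on which \<open>u\<close> vanishes.\<close>
    have x: "x = w - (T z - \<mu> *\<^sub>C z)"
      using z(1) \<nu>z by (simp add: algebra_simps)
    have uw: "u w = u x"
      using u[of z] unfolding x by (simp add: blinfun.bilinear_simps)
    have Tw: "T w = e *\<^sub>R (\<mu> *\<^sub>C T z)"
      using T by (simp add: w_def bounded_clinear_def scaleR_scaleC)
    \<comment> \<open>\<open>B\<close> commutes with the scalar \<open>e * \<mu>\<close> in the
      definition of \<open>w\<close>, and \<open>B z = w - x\<close>. As \<open>w\<close> is bounded
      independently of \<open>e\<close>, the factor \<open>e\<close> makes \<open>B w\<close>
      small.\<close>
    have "B w = e *\<^sub>R (\<mu> *\<^sub>C (w - x))"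
    proof -
      have "w - x = T z - \<mu> *\<^sub>C z" using x by simp
      then show ?thesis
        unfolding B Tw by (simp add: w_def scaleR_scaleC scaleC_scaleC scaleC_diff_right mult_ac)
    qed
    then have "norm (B w) \<le> e * (norm w + norm x)"
      using e norm_triangle_ineq4[of w x] by (simp add: norm_scaleC \<mu>)
    also have "\<dots> \<le> e * ((C + 1) * norm x)"
      using nw e by (simp add: algebra_simps)
    finally have nB: "norm (B w) \<le> e * ((C + 1) * norm x)" .
    have "\<bar>g (B w)\<bar> \<le> norm g * norm (B w)"
      using norm_blinfun[of g "B w"] by simp
    also have "\<dots> \<le> norm g * (e * ((C + 1) * norm x))"
      using nB by (simp add: mult_left_mono)
    also have "\<dots> = e * D"
      by (simp add: D_def)
    finally have gB: "\<bar>g (B w)\<bar> \<le> e * D" .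
    have "\<bar>u w + g (B w)\<bar> \<le> norm (u + (g o\<^sub>L B)) * norm w"
      using norm_blinfun[of "u + (g o\<^sub>L B)" w] by (simp add: blinfun.bilinear_simps)
    also have "\<dots> \<le> norm (u + (g o\<^sub>L B)) * (C * norm x)"
      using nw by (simp add: mult_left_mono)
    finally show ?thesis
      using gB uw by linarith
  qed
  have "D \<ge> 0" using C by (simp add: D_def)
  show ?thesis
  proof (rule field_le_epsilon)
    fix e :: real assume "e > 0"
    \<comment> \<open>Dividing by \<open>D + 1\<close> rather than \<open>D\<close> covers the case
      \<open>D = 0\<close>.\<close>
    moreover have "e / (D + 1) * D \<le> e"
      using \<open>e > 0\<close> \<open>D \<ge> 0\<close> by (simp add: field_simps)
    ultimately show "\<bar>u x\<bar> \<le> norm (u + (g o\<^sub>L B)) * (C * norm x) + e"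
      using *[of "e / (D + 1)"] \<open>D \<ge> 0\<close> by simp
  qed
qed

section \<open>Excluding residual spectrum outside the open disc\<close>

theorem theorem3p2:
  fixes T :: "'a::complex_banach \<Rightarrow> 'a"
  assumes "reflexive_space TYPE('a)"
    and "bounded_clinear T"
    and "kreiss_bounded T"
  shows "residual_spectrum T \<subseteq> {\<mu>. cmod \<mu> < 1}"
proof (rule subsetI, rule ccontr)
  fix \<mu> assume "\<mu> \<in> residual_spectrum T" and "\<mu> \<notin> {\<mu>. cmod \<mu> < 1}"
  then have inj: "inj (\<lambda>x. T x - \<mu> *\<^sub>C x)" and dense: "closure (range (\<lambda>x. T x - \<mu> *\<^sub>C x)) \<noteq> UNIV"
    and ge1: "cmod \<mu> \<ge> 1"
    by (auto simp: residual_spectrum_def)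
  obtain C where C: "C > 0"
    and res: "\<And>\<nu> x. cmod \<nu> > 1 \<Longrightarrow> \<exists>z. \<nu> *\<^sub>C z - T z = x \<and> (cmod \<nu> - 1) * norm z \<le> C * norm x"
    using kreiss_bounded_resolvent[OF assms(3)] by metis
  have "cmod \<mu> = 1"
  proof (rule ccontr)
    assume "cmod \<mu> \<noteq> 1"
    then have gt1: "cmod \<mu> > 1" using ge1 by simp
    \<comment> \<open>Off the closed disc the resolvent makes the range everything, contradicting
      its failure to be dense.\<close>
    have "x \<in> range (\<lambda>x. T x - \<mu> *\<^sub>C x)" for x
    proof -
      obtain z where "\<mu> *\<^sub>C z - T z = - x" using res[OF gt1] by blast
      then have "x = T z - \<mu> *\<^sub>C z" by (metis minus_diff_eq minus_minus)
      then show ?thesis by blast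
    qed
    then have "range (\<lambda>x. T x - \<mu> *\<^sub>C x) = UNIV" by blast
    then show False using dense by simp
  qed
  have blT: "bounded_linear T"
    using assms(2) by (simp add: bounded_clinear_def)
  define B where "B = Blinfun (\<lambda>x. T x - \<mu> *\<^sub>C x)"
  have B: "blinfun_apply B x = T x - \<mu> *\<^sub>C x" for x
    by (simp add: B_def bounded_linear_Blinfun_apply bounded_linear_sub[OF blT bounded_linear_scaleC])
  have "range B = range (\<lambda>x. T x - \<mu> *\<^sub>C x)"
    by (simp add: B)
  then obtain a where "a \<notin> closure (range B)"
    using dense by auto
  moreover have "subspace (range B)"
    using linear_subspace_image[OF bounded_linear.linear[OF blinfun.bounded_linear_right] subspace_UNIV] .
  ultimately obtain u :: "'a \<Rightarrow>\<^sub>L real" where ua: "u a \<noteq> 0" and u: "\<And>x. u (B x) = 0"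
    using hahn_banach_separation by blast
  have "u \<notin> closure (range (\<lambda>g :: 'a \<Rightarrow>\<^sub>L real. g o\<^sub>L B))"
  proof
    assume "u \<in> closure (range (\<lambda>g :: 'a \<Rightarrow>\<^sub>L real. g o\<^sub>L B))"
    have a0: "norm a > 0" using ua by auto
    \<comment> \<open>This radius is the gap that \<open>kreiss_bounded_functional_bound\<close>
      gives at \<open>a\<close>. The approximating \<open>g\<close> enters that bound as
      \<open>- g\<close>.\<close>
    then have "\<bar>u a\<bar> / (C * norm a) > 0" using ua C by simp
    then obtain g :: "'a \<Rightarrow>\<^sub>L real" where "dist (g o\<^sub>L B) u < \<bar>u a\<bar> / (C * norm a)"
      using \<open>u \<in> _\<close> unfolding closure_approachable by blast
    moreover have "(- g) o\<^sub>L B = - (g o\<^sub>L B)"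
      by (rule blinfun_eqI) (simp add: blinfun.bilinear_simps)
    ultimately have "norm (u + ((- g) o\<^sub>L B)) < \<bar>u a\<bar> / (C * norm a)"
      by (simp add: dist_norm norm_minus_commute)
    then have "norm (u + ((- g) o\<^sub>L B)) * (C * norm a) < \<bar>u a\<bar>"
      using a0 C by (simp add: pos_less_divide_eq)
    moreover have "\<bar>u a\<bar> \<le> norm (u + ((- g) o\<^sub>L B)) * (C * norm a)"
      using kreiss_bounded_functional_bound[OF assms(2) \<open>cmod \<mu> = 1\<close> C res B] u unfolding B by blast
    ultimately show False by simp
  qed
  then obtain L :: "('a \<Rightarrow>\<^sub>L real) \<Rightarrow>\<^sub>L real"
    where Lu: "L u \<noteq> 0" and LB: "\<And>g. L (g o\<^sub>L B) = 0"
    using hahn_banach_separation[OF subspace_range_compose] by blast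
  obtain y where y: "\<And>g. L g = g y"
    using reflexive_space_real[OF assms(1)] by blast
  have "B y = 0"
  proof (rule ccontr)
    assume "B y \<noteq> 0"
    \<comment> \<open>Separating \<open>B y\<close> from the zero subspace gives a functional with
      \<open>g (B y) \<noteq> 0\<close>, but \<open>g (B y)\<close> is the value of \<open>L\<close>
      at \<open>g o\<^sub>L B\<close>, which is 0.\<close>
    then obtain g :: "'a \<Rightarrow>\<^sub>L real" where "g (B y) \<noteq> 0"
      using hahn_banach_separation[OF subspace_single_0, of "B y"] by auto
    then show False using LB[of g] y by simp
  qed
  then have "T y - \<mu> *\<^sub>C y = T 0 - \<mu> *\<^sub>C 0"
    using B[of y] B[of 0] by simp
  then have "y = 0"
    using inj by (auto dest: injD)
  then show False
    using Lu y by simp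
qed

end
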